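(* Let $\{\varphi_n(r)\}_{n=0}^\infty\in\mathcal F$ and let $\Phi_1(r)=\sum_{n=1}^\infty\varphi_n(r)$. Let $R\in(0,1)$ be the minimal positive root of the equation $1=2\Phi_1(x)$, and suppose that $1\ge2\Phi_1(r)$ for all $r\in[0,R]$. Then for every univalent and convex analytic function $f(z)=\sum_{n=0}^\infty a_nz^n$ in $\mathbb D$, with $\Omega=f(\mathbb D)$, and every $g(z)=\sum_{n=0}^\infty b_nz^n\in\mathcal S(f)$, one has $$\sum_{n=1}^\infty|b_n|\varphi_n(r)\le\operatorname{dist}(f(0),\partial\Omega)\quad\text{for all } r\in[0,R].$$ Moreover, if $1<2\Phi_1(x)$ for all $x$ in some interval $(R,R+\epsilon)\subset(0,1)$ with $\epsilon>0$, then the number $R$ cannot be improved: for every $R'\in(R,1)$ there exist a univalent and convex analytic function $f$ in $\mathbb D$, a function $g(z)=\sum_{n=0}^\infty b_nz^n\in\mathcal S(f)$ and $r\in(R,R')$ such that $\sum_{n=1}^\infty|b_n|\varphi_n(r)>\operatorname{dist}(f(0),\partial f(\mathbb D))$.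
   Context: $\mathbb D=\{z\in\mathbb C:|z|<1\}$. $\mathcal F$ is the set of all sequences $\{\varphi_n(r)\}_{n=0}^\infty$ of nonnegative continuous functions on $[0,1)$ such that $\sum_{n=0}^\infty\varphi_n(r)$ converges locally uniformly with respect to $r\in[0,1)$. A univalent analytic function $f$ in $\mathbb D$ is convex if $f(\mathbb D)$ is a convex domain. For analytic $f,g$ in $\mathbb D$, $g$ is subordinate to $f$ ($g\prec f$) if there is an analytic $\omega$ in $\mathbb D$ with $\omega(0)=0$, $|\omega(z)|<1$ and $g=f\circ\omega$. $\mathcal S(f)$ is the class of all analytic functions $g$ in $\mathbb D$ subordinate to $f$. $\operatorname{dist}(w,\partial\Omega)$ is the Euclidean distance from $w$ to the boundary of $\Omega$. *)

theory Defs
  imports "HOL-Complex_Analysis.Complex_Analysis"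
begin

abbreviation unit_disc :: "complex set" where
  "unit_disc \<equiv> ball 0 1"

definition bohr_family :: "(nat \<Rightarrow> real \<Rightarrow> real) set" where
  "bohr_family = {\<phi>.
     (\<forall>n. continuous_on {0..<1} (\<phi> n)) \<and>
     (\<forall>n. \<forall>r\<in>{0..<1}. 0 \<le> \<phi> n r) \<and>
     (\<forall>r\<in>{0..<1}. \<exists>\<delta>>0.
        uniformly_convergent_on ({0..<1} \<inter> ball r \<delta>) (\<lambda>N x. \<Sum>n<N. \<phi> n x))}"

definition Phi1 :: "(nat \<Rightarrow> real \<Rightarrow> real) \<Rightarrow> real \<Rightarrow> real" where
  "Phi1 \<phi> r = (\<Sum>n. \<phi> (Suc n) r)"

text \<open>The image of the disc is automatically a domain: it is open by the open mapping
  theorem and connected because it is convex.\<close>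

definition convex_univalent :: "(complex \<Rightarrow> complex) \<Rightarrow> bool" where
  "convex_univalent f \<longleftrightarrow>
     f holomorphic_on unit_disc \<and> inj_on f unit_disc \<and> convex (f ` unit_disc)"

text \<open>Functions on the disc are total functions on \<open>complex\<close>;
  their values outside the disc are irrelevant.\<close>

definition subordinate :: "(complex \<Rightarrow> complex) \<Rightarrow> (complex \<Rightarrow> complex) \<Rightarrow> bool" where
  "subordinate g f \<longleftrightarrow>
     (\<exists>\<omega>. \<omega> holomorphic_on unit_disc \<and> \<omega> 0 = 0 \<and>
          (\<forall>z\<in>unit_disc. norm (\<omega> z) < 1) \<and> (\<forall>z\<in>unit_disc. g z = f (\<omega> z)))"

definition subordination_class :: "(complex \<Rightarrow> complex) \<Rightarrow> (complex \<Rightarrow> complex) set" where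
  "subordination_class f = {g. g holomorphic_on unit_disc \<and> subordinate g f}"

definition has_power_series :: "(complex \<Rightarrow> complex) \<Rightarrow> (nat \<Rightarrow> complex) \<Rightarrow> bool" where
  "has_power_series g b \<longleftrightarrow> (\<forall>z\<in>unit_disc. (\<lambda>n. b n * z ^ n) sums g z)"

end

theory Submission
  imports Defs
begin

text \<open>
  The first half rests on the single bound \<open>norm (b n) \<le> 2 * infdist (f 0) (frontier \<Omega>)\<close> for
  \<open>n \<ge> 1\<close>, where \<open>\<Omega>\<close> is the image of the disc under \<open>f\<close>: multiplying it by \<open>\<phi> n r\<close> and summing
  gives \<open>2 * Phi1 \<phi> r\<close> times the distance, and \<open>2 * Phi1 \<phi> r \<le> 1\<close> on \<open>{0..R}\<close>.

  The coefficient bound uses convexity only through separating half-planes. If \<open>p\<close> is a point outside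
  the convex set \<open>\<Omega>\<close>, a hyperplane separates \<open>p\<close> from \<open>\<Omega>\<close>, so that after a rotation \<open>p - g\<close> has
  nonnegative real part on the disc. Caratheodory's inequality bounds the higher coefficients of
  such a function by twice the real part of its value at \<open>0\<close>, hence by \<open>2 * dist (g 0) p\<close>, and
  \<open>g 0 = f 0\<close>. Frontier points are admissible choices of \<open>p\<close> because \<open>\<Omega>\<close> is open, and one of them
  realises the distance because \<open>\<Omega>\<close> is not the whole plane (Liouville's theorem).

  The second half uses the extremal case \<open>f = g = (\<lambda>z. 1 / (1 - z))\<close>, which maps the disc
  onto the half-plane \<open>{w. Re w > 1 / 2}\<close>. All its coefficients are \<open>1\<close>, so the sum is
  \<open>Phi1 \<phi> r\<close>, while \<open>f 0 = 1\<close> has distance \<open>1 / 2\<close> from the boundary line.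
\<close>

section \<open>Coefficients of functions with nonnegative real part\<close>

lemma power_series_coefficient_unique:
  fixes h :: "complex \<Rightarrow> complex"
  assumes "has_power_series h c"
  shows "c n = (deriv ^^ n) h 0 / fact n"
proof -
  have "eventually (\<lambda>z. z \<in> unit_disc) (nhds (0::complex))"
    by (intro eventually_nhds_in_open) auto
  then have "h has_fps_expansion Abs_fps c"
    using assms unfolding has_power_series_def
    by (intro has_fps_expansionI) (auto elim: eventually_mono)
  from fps_nth_fps_expansion[OF this, of n] show ?thesis by simp
qed

text \<open>On the circle of radius \<open>\<rho>\<close> the function \<open>h\<close> is integrated against the nonnegative weight
  \<open>2 + 2 * Re (m * cnj e ^ n)\<close>, where \<open>e\<close> is the position on the unit circle. Its three Fourier
  modes \<open>0\<close>, \<open>n\<close>, \<open>- n\<close> pick out \<open>2 * h 0\<close>, \<open>m * \<rho> ^ n * c n\<close> and \<open>0\<close>.\<close>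

lemma nonneg_Re_imp_kernel_nonneg:
  fixes h :: "complex \<Rightarrow> complex"
  assumes ser: "has_power_series h c"
    and pos: "\<And>z. z \<in> unit_disc \<Longrightarrow> 0 \<le> Re (h z)"
    and n: "0 < n" and \<rho>: "0 < \<rho>" "\<rho> < 1" and m: "norm m = 1"
  shows "0 \<le> Re (2 * h 0 + m * of_real \<rho> ^ n * c n)"
proof -
  have hol: "h holomorphic_on unit_disc"
    using ser power_series_holomorphic[of 0 1 c h] by (auto simp: has_power_series_def)
  have sub: "cball 0 \<rho> \<subseteq> unit_disc" "ball 0 \<rho> \<subseteq> unit_disc" using \<rho> by auto
  have holr: "h holomorphic_on ball 0 \<rho>" and contr: "continuous_on (cball 0 \<rho>) h"
    using holomorphic_on_subset[OF hol] sub by (auto intro: holomorphic_on_imp_continuous_on)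
  let ?\<gamma> = "circlepath 0 \<rho>"
  have mode: "((\<lambda>u. h u / u ^ Suc k) has_contour_integral (2 * pi * \<i>) * c k) ?\<gamma>" for k
    using Cauchy_has_contour_integral_higher_derivative_circlepath[OF contr holr, of 0 k] \<rho>
      power_series_coefficient_unique[OF ser, of k] by simp
  have c0: "c 0 = h 0" using power_series_coefficient_unique[OF ser, of 0] by simp
  have mode_neg: "((\<lambda>u. h u * u ^ (n - 1)) has_contour_integral 0) ?\<gamma>"
    by (rule Cauchy_theorem_disc_simple[of _ 0 1])
       (use \<rho> in \<open>auto intro!: holomorphic_intros hol\<close>)
  let ?F = "\<lambda>u. 2 * (h u / u ^ Suc 0) + (m * of_real \<rho> ^ n) * (h u / u ^ Suc n)
                + (cnj m / of_real \<rho> ^ n) * (h u * u ^ (n - 1))"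
  have F: "(?F has_contour_integral
          (2 * ((2 * pi * \<i>) * c 0) + (m * of_real \<rho> ^ n) * ((2 * pi * \<i>) * c n)
           + (cnj m / of_real \<rho> ^ n) * 0)) ?\<gamma>"
    by (intro has_contour_integral_add has_contour_integral_lmul mode mode_neg)
  define e where "e t = exp (2 * of_real pi * \<i> * of_real t)" for t :: real
  have ne: "norm (e t) = 1" for t by (simp add: e_def norm_exp_eq_Re)
  have e0: "e t \<noteq> 0" for t by (simp add: e_def)
  let ?w = "\<lambda>t. 2 + 2 * Re (m * cnj (e t) ^ n)"
  have integrand: "?F (?\<gamma> t) * vector_derivative ?\<gamma> (at t)
      = (2 * pi * \<i>) * (h (of_real \<rho> * e t) * of_real (?w t))" for t
  proof -
    have u: "?\<gamma> t = of_real \<rho> * e t" by (simp add: circlepath e_def)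
    have v: "vector_derivative ?\<gamma> (at t) = 2 * pi * \<i> * (of_real \<rho> * e t)"
      by (simp add: vector_derivative_circlepath e_def)
    have ec: "cnj (e t) = inverse (e t)"
      using ne[of t] e0[of t] complex_norm_square[of "e t"] by (simp add: field_simps)
    have Re2: "of_real (?w t) = 2 + m * cnj (e t) ^ n + cnj m * e t ^ n"
      using complex_add_cnj[of "m * cnj (e t) ^ n"] by (simp add: algebra_simps)
    let ?u = "of_real \<rho> * e t" and ?H = "h (of_real \<rho> * e t)"
    have u0: "?u \<noteq> 0" using \<rho> e0[of t] by simp
    have t0: "?H / ?u ^ Suc 0 * ?u = ?H" using u0 by simp
    have "?H / ?u ^ Suc n * ?u = ?H / ?u ^ n" using u0 by simp
    then have t1: "of_real \<rho> ^ n * (?H / ?u ^ Suc n) * ?u = ?H * cnj (e t) ^ n"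
      using \<rho> e0[of t] by (simp add: ec power_mult_distrib power_inverse field_simps)
    have "?u ^ (n - 1) * ?u = ?u ^ n" using n by (metis power_minus_mult)
    then have t2: "(?H * ?u ^ (n - 1)) / of_real \<rho> ^ n * ?u = ?H * e t ^ n"
      using \<rho> by (simp add: power_mult_distrib mult.assoc)
    have "?F ?u * (2 * pi * \<i> * ?u) = (2 * pi * \<i>) * (2 * (?H / ?u ^ Suc 0 * ?u)
        + m * (of_real \<rho> ^ n * (?H / ?u ^ Suc n) * ?u)
        + cnj m * ((?H * ?u ^ (n - 1)) / of_real \<rho> ^ n * ?u))"
      by (simp only: distrib_left distrib_right times_divide_eq_left times_divide_eq_right mult_ac)
    then show ?thesis
      unfolding u v Re2 t0 t1 t2 by (simp only: distrib_left mult_ac)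
  qed
  have total: "2 * ((2 * pi * \<i>) * c 0) + (m * of_real \<rho> ^ n) * ((2 * pi * \<i>) * c n)
      + (cnj m / of_real \<rho> ^ n) * 0 = (2 * pi * \<i>) * (2 * h 0 + m * of_real \<rho> ^ n * c n)"
    by (simp add: c0 algebra_simps)
  have cancel: "inverse (2 * pi * \<i>) * ((2 * pi * \<i>) * x) = x" for x :: complex
    by (subst mult.assoc[symmetric], subst left_inverse) simp_all
  have int: "((\<lambda>t. (2 * pi * \<i>) * (h (of_real \<rho> * e t) * of_real (?w t))) has_integral
          (2 * pi * \<i>) * (2 * h 0 + m * of_real \<rho> ^ n * c n)) {0..1}"
    using F unfolding has_contour_integral integrand total .
  have "((\<lambda>t. h (of_real \<rho> * e t) * of_real (?w t)) has_integral
          (2 * h 0 + m * of_real \<rho> ^ n * c n)) {0..1}"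
    using has_integral_mult_right[OF int, of "inverse (2 * pi * \<i>)"]
    by (simp only: cancel)
  then have "((\<lambda>t. Re (h (of_real \<rho> * e t) * of_real (?w t))) has_integral
          Re (2 * h 0 + m * of_real \<rho> ^ n * c n)) {0..1}"
    by (rule has_integral_Re)
  then show ?thesis
  proof (rule has_integral_nonneg)
    fix t :: real
    have "0 \<le> Re (h (of_real \<rho> * e t))"
      using \<rho> by (intro pos) (simp add: norm_mult ne)
    moreover have "\<bar>Re (m * cnj (e t) ^ n)\<bar> \<le> norm (m * cnj (e t) ^ n)"
      by (rule abs_Re_le_cmod)
    then have "0 \<le> ?w t" by (simp add: norm_mult norm_power ne m)
    ultimately show "0 \<le> Re (h (of_real \<rho> * e t) * of_real (?w t))" by simp
  qed
qed

text \<open>The phase \<open>m\<close> is chosen to turn \<open>m * c n\<close> into \<open>- norm (c n)\<close>; then \<open>\<rho>\<close> tends to \<open>1\<close>.\<close>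

lemma Caratheodory_coefficient_bound:
  fixes h :: "complex \<Rightarrow> complex"
  assumes ser: "has_power_series h c"
    and pos: "\<And>z. z \<in> unit_disc \<Longrightarrow> 0 \<le> Re (h z)" and n: "0 < n"
  shows "norm (c n) \<le> 2 * Re (h 0)"
proof -
  obtain m where m: "norm m = 1" "m * c n = - of_real (norm (c n))"
  proof (cases "c n = 0")
    case True
    then show ?thesis using that[of 1] by simp
  next
    case False
    then have "cnj (c n) * c n = of_real (norm (c n)) * of_real (norm (c n))"
      using complex_norm_square[of "c n"] by (simp add: power2_eq_square mult.commute)
    then show ?thesis
      using False by (intro that[of "- cnj (c n) / of_real (norm (c n))"]) (simp_all add: norm_divide)
  qed
  have bound: "\<rho> ^ n * norm (c n) \<le> 2 * Re (h 0)" if "0 < \<rho>" "\<rho> < 1" for \<rho> :: real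
  proof -
    have "m * of_real \<rho> ^ n * c n = - of_real (\<rho> ^ n * norm (c n))"
      using arg_cong[OF m(2), of "\<lambda>x. of_real \<rho> ^ n * x"] by (simp add: mult_ac)
    with nonneg_Re_imp_kernel_nonneg[OF ser pos n that m(1)]
    have "0 \<le> Re (2 * h 0 + - of_real (\<rho> ^ n * norm (c n)))" by simp
    then show ?thesis by simp
  qed
  show ?thesis
  proof (rule tendsto_upperbound)
    show "((\<lambda>\<rho>. \<rho> ^ n * norm (c n)) \<longlongrightarrow> norm (c n)) (at_left (1::real))"
      by (auto intro!: tendsto_eq_intros)
    show "\<forall>\<^sub>F \<rho> in at_left (1::real). \<rho> ^ n * norm (c n) \<le> 2 * Re (h 0)"
      using eventually_at_left_real[of 0 "1::real"] by (rule eventually_mono) (auto intro: bound)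
  qed simp
qed

section \<open>Functions with values in a convex domain\<close>

text \<open>A convex set lies on one side of a line through any point \<open>p\<close> outside it, which turns
  \<open>p - g\<close>, up to a rotation, into a function with nonnegative real part.\<close>

lemma coefficient_bound_convex_range:
  fixes g :: "complex \<Rightarrow> complex"
  assumes ser: "has_power_series g b" and S: "convex S"
    and gS: "\<And>z. z \<in> unit_disc \<Longrightarrow> g z \<in> S" and p: "p \<notin> S" and n: "0 < n"
  shows "norm (b n) \<le> 2 * dist (g 0) p"
proof -
  have "S \<noteq> {}" using gS[of 0] by auto
  then obtain a d where a: "a \<noteq> 0" "\<forall>x\<in>S. a \<bullet> x \<le> d" "d \<le> a \<bullet> p"
    using separating_hyperplane_sets[OF S convex_singleton[of p]] p by auto
  define h where "h z = cnj a * (p - g z)" for z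
  define c where "c k = cnj a * ((if k = 0 then p else 0) - b k)" for k
  have "has_power_series h c"
    unfolding has_power_series_def
  proof
    fix z :: complex assume "z \<in> unit_disc"
    with ser have "(\<lambda>k. b k * z ^ k) sums g z" by (simp add: has_power_series_def)
    moreover have "(\<lambda>k. if k = 0 then p else 0) sums p"
      using sums_single[of 0 "\<lambda>_. p"] by simp
    ultimately have "(\<lambda>k. cnj a * ((if k = 0 then p else 0) - b k * z ^ k)) sums h z"
      unfolding h_def by (intro sums_mult sums_diff)
    then show "(\<lambda>k. c k * z ^ k) sums h z"
      by (rule sums_cong[THEN iffD1, rotated]) (auto simp: c_def algebra_simps)
  qed
  moreover have "0 \<le> Re (h z)" if "z \<in> unit_disc" for z
  proof -
    have "a \<bullet> g z \<le> a \<bullet> p" using a gS[OF that] by force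
    then show ?thesis by (simp add: h_def inner_complex_def algebra_simps)
  qed
  ultimately have "norm (c n) \<le> 2 * Re (h 0)"
    using n by (rule Caratheodory_coefficient_bound)
  also have "\<dots> \<le> 2 * norm (h 0)" using complex_Re_le_cmod[of "h 0"] by simp
  finally have "norm a * norm (b n) \<le> norm a * (2 * dist (g 0) p)"
    using n by (simp add: c_def h_def norm_mult dist_norm norm_minus_commute)
  then show ?thesis using a(1) by simp
qed

text \<open>Otherwise the inverse function would be a bounded nonconstant entire function.\<close>

lemma univalent_image_disc_not_UNIV:
  assumes "f holomorphic_on unit_disc" "inj_on f unit_disc"
  shows "f ` unit_disc \<noteq> UNIV"
proof
  assume U: "f ` unit_disc = UNIV"
  obtain k where k: "k holomorphic_on (f ` unit_disc)" "\<And>z. z \<in> unit_disc \<Longrightarrow> k (f z) = z"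
    using holomorphic_has_inverse[OF assms(1) open_ball assms(2)] by metis
  have "range k = (\<lambda>z. k (f z)) ` unit_disc" unfolding image_image[symmetric] U ..
  also have "\<dots> = unit_disc" using k(2) by force
  finally have "bounded (range k)" by simp
  then have "k constant_on UNIV" using k(1) U by (intro Liouville_theorem) auto
  then have "(0::complex) = 1 / 2"
    using k(2)[of 0] k(2)[of "1 / 2"] by (auto simp: constant_on_def)
  then show False by simp
qed

lemma coefficient_bound_subordinate:
  assumes f: "convex_univalent f" and g: "g \<in> subordination_class f"
    and ser: "has_power_series g b" and n: "0 < n"
  shows "norm (b n) \<le> 2 * infdist (f 0) (frontier (f ` unit_disc))"
proof -
  let ?\<Omega> = "f ` unit_disc"
  have hol: "f holomorphic_on unit_disc" and inj: "inj_on f unit_disc" and cvx: "convex ?\<Omega>"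
    using f by (auto simp: convex_univalent_def)
  have "open ?\<Omega>" using open_mapping_thm3[OF hol open_ball inj] .
  have "frontier ?\<Omega> \<noteq> {}"
    using univalent_image_disc_not_UNIV[OF hol inj] by (intro frontier_not_empty) auto
  then obtain p where p: "p \<in> frontier ?\<Omega>" "infdist (f 0) (frontier ?\<Omega>) = dist (f 0) p"
    using infdist_attains_inf[OF frontier_closed] by metis
  have "p \<notin> ?\<Omega>" using p(1) \<open>open ?\<Omega>\<close> by (simp add: frontier_def interior_open)
  obtain \<omega> where \<omega>: "\<omega> 0 = 0" "\<And>z. z \<in> unit_disc \<Longrightarrow> norm (\<omega> z) < 1"
      "\<And>z. z \<in> unit_disc \<Longrightarrow> g z = f (\<omega> z)"
    using g by (auto simp: subordination_class_def subordinate_def)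
  have "g z \<in> ?\<Omega>" if "z \<in> unit_disc" for z using \<omega>(2,3)[OF that] by auto
  from coefficient_bound_convex_range[OF ser cvx this \<open>p \<notin> ?\<Omega>\<close> n]
  show ?thesis using p(2) \<omega>(1) \<omega>(3)[of 0] by simp
qed

section \<open>The extremal half-plane map\<close>

text \<open>With \<open>w = 1 / (1 - z)\<close>, the condition \<open>norm z < 1\<close> says that \<open>w\<close> is closer to \<open>1\<close> than
  to \<open>0\<close>, and the perpendicular bisector of these points is \<open>Re w = 1 / 2\<close>.\<close>

lemma image_inverse_one_minus_disc:
  "(\<lambda>z::complex. 1 / (1 - z)) ` unit_disc = {w. Re w > 1 / 2}"
proof -
  have iff: "norm (1 - 1 / w) < 1 \<longleftrightarrow> Re w > 1 / 2" if "w \<noteq> 0" for w :: complex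
  proof -
    have "1 - 1 / w = (w - 1) / w" using that by (simp add: field_simps)
    then have "norm (1 - 1 / w) < 1 \<longleftrightarrow> norm (w - 1) < norm w"
      using that by (simp add: norm_divide divide_less_eq_1)
    also have "\<dots> \<longleftrightarrow> (norm (w - 1))\<^sup>2 < (norm w)\<^sup>2"
      by (meson norm_ge_zero power2_less_imp_less power_strict_mono zero_less_numeral)
    also have "\<dots> \<longleftrightarrow> Re w > 1 / 2"
      unfolding cmod_power2 by (simp add: power2_eq_square algebra_simps)
    finally show ?thesis .
  qed
  show ?thesis
  proof (intro equalityI subsetI)
    fix w assume "w \<in> (\<lambda>z::complex. 1 / (1 - z)) ` unit_disc"
    then obtain z :: complex where z: "w = 1 / (1 - z)" "norm z < 1" by auto
    then have "z \<noteq> 1" by auto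
    then have "w \<noteq> 0" "1 - 1 / w = z" using z(1) by simp_all
    then show "w \<in> {w. Re w > 1 / 2}" using iff[of w] z by simp
  next
    fix w :: complex assume w: "w \<in> {w. Re w > 1 / 2}"
    then have "w \<noteq> 0" by auto
    then show "w \<in> (\<lambda>z. 1 / (1 - z)) ` unit_disc"
      using iff[of w] w by (intro image_eqI[of _ _ "1 - 1 / w"]) auto
  qed
qed

lemma convex_univalent_inverse_one_minus: "convex_univalent (\<lambda>z. 1 / (1 - z))"
  unfolding convex_univalent_def
proof (intro conjI)
  show "(\<lambda>z::complex. 1 / (1 - z)) holomorphic_on unit_disc"
    by (auto intro!: holomorphic_intros)
  show "inj_on (\<lambda>z::complex. 1 / (1 - z)) unit_disc"
    by (rule inj_onI) (simp add: divide_inverse)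
  show "convex ((\<lambda>z::complex. 1 / (1 - z)) ` unit_disc)"
    by (simp only: image_inverse_one_minus_disc convex_halfspace_Re_gt)
qed

lemma convex_univalent_in_subordination_class:
  assumes "convex_univalent f"
  shows "f \<in> subordination_class f"
  using assms unfolding subordination_class_def subordinate_def convex_univalent_def
  by (auto intro!: exI[of _ "\<lambda>z. z"] holomorphic_intros)

lemma infdist_frontier_inverse_one_minus_disc:
  "infdist 1 (frontier ((\<lambda>z::complex. 1 / (1 - z)) ` unit_disc)) \<le> 1 / 2"
proof -
  have "frontier {w. Re w > 1 / 2} = {w. Re w = 1 / 2}"
    using frontier_halfspace_gt[of "1::complex" "1 / 2"] by (simp add: inner_complex_def)
  then show ?thesis
    unfolding image_inverse_one_minus_disc
    by (intro infdist_le2[of "1 / 2"]) (auto simp: dist_norm)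
qed

section \<open>The Bohr radius\<close>

lemma bohr_family_summable:
  assumes "\<phi> \<in> bohr_family" and r: "r \<in> {0..<1}"
  shows "summable (\<lambda>n. \<phi> (Suc n) r)"
proof -
  obtain \<delta> where "\<delta> > 0"
      "uniformly_convergent_on ({0..<1} \<inter> ball r \<delta>) (\<lambda>N x. \<Sum>n<N. \<phi> n x)"
    using assms unfolding bohr_family_def by blast
  then have "convergent (\<lambda>N. \<Sum>n<N. \<phi> n r)"
    using r by (intro uniformly_convergent_imp_convergent) auto
  then show ?thesis using summable_Suc_iff[of "\<lambda>n. \<phi> n r"] by (simp add: summable_iff_convergent)
qed

theorem theorem4:
  fixes \<phi> :: "nat \<Rightarrow> real \<Rightarrow> real" and R :: real
  assumes "\<phi> \<in> bohr_family"
    and "0 < R" and "R < 1"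
    and "1 = 2 * Phi1 \<phi> R"
    and "\<forall>x. 0 < x \<and> x < R \<longrightarrow> 1 \<noteq> 2 * Phi1 \<phi> x"
    and "\<forall>r\<in>{0..R}. 1 \<ge> 2 * Phi1 \<phi> r"
  shows "(\<forall>f g b. convex_univalent f \<longrightarrow> g \<in> subordination_class f \<longrightarrow> has_power_series g b \<longrightarrow>
            (\<forall>r\<in>{0..R}.
               summable (\<lambda>n. norm (b (Suc n)) * \<phi> (Suc n) r) \<and>
               (\<Sum>n. norm (b (Suc n)) * \<phi> (Suc n) r)
                 \<le> infdist (f 0) (frontier (f ` unit_disc)))) \<and>
         ((\<exists>\<epsilon>>0. {R<..<R + \<epsilon>} \<subseteq> {0<..<1} \<and> (\<forall>x\<in>{R<..<R + \<epsilon>}. 1 < 2 * Phi1 \<phi> x)) \<longrightarrow>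
          (\<forall>R'. R < R' \<and> R' < 1 \<longrightarrow>
            (\<exists>f g b r. convex_univalent f \<and> g \<in> subordination_class f \<and> has_power_series g b \<and>
               r \<in> {R<..<R'} \<and>
               summable (\<lambda>n. norm (b (Suc n)) * \<phi> (Suc n) r) \<and>
               (\<Sum>n. norm (b (Suc n)) * \<phi> (Suc n) r)
                 > infdist (f 0) (frontier (f ` unit_disc)))))"
proof (intro conjI allI impI ballI)
  fix f g b r
  assume fgb: "convex_univalent f" "g \<in> subordination_class f" "has_power_series g b"
    and r: "r \<in> {0..R}"
  define d where "d = infdist (f 0) (frontier (f ` unit_disc))"
  have r1: "r \<in> {0..<1}" using r \<open>R < 1\<close> by auto
  have \<phi>0: "0 \<le> \<phi> n r" for n using assms(1) r1 by (auto simp: bohr_family_def)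
  have sm: "summable (\<lambda>n. \<phi> (Suc n) r)" using bohr_family_summable[OF assms(1) r1] .
  have le: "norm (b (Suc n)) * \<phi> (Suc n) r \<le> 2 * d * \<phi> (Suc n) r" for n
    using coefficient_bound_subordinate[OF fgb, of "Suc n"] \<phi>0
    by (intro mult_right_mono) (auto simp: d_def)
  have sm2: "summable (\<lambda>n. 2 * d * \<phi> (Suc n) r)" using sm by (rule summable_mult)
  show sm3: "summable (\<lambda>n. norm (b (Suc n)) * \<phi> (Suc n) r)"
    by (rule summable_comparison_test'[OF sm2]) (use le \<phi>0 in \<open>simp add: abs_mult\<close>)
  have "(\<Sum>n. norm (b (Suc n)) * \<phi> (Suc n) r) \<le> (\<Sum>n. 2 * d * \<phi> (Suc n) r)"
    using le sm3 sm2 by (rule suminf_le)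
  also have "\<dots> = d * (2 * Phi1 \<phi> r)" using suminf_mult[OF sm] by (simp add: Phi1_def)
  also have "\<dots> \<le> d"
    using assms(6) r by (intro mult_left_le) (auto simp: d_def infdist_nonneg)
  finally show "(\<Sum>n. norm (b (Suc n)) * \<phi> (Suc n) r)
      \<le> infdist (f 0) (frontier (f ` unit_disc))" by (simp add: d_def)
next
  fix R'
  assume "\<exists>\<epsilon>>0. {R<..<R + \<epsilon>} \<subseteq> {0<..<1} \<and> (\<forall>x\<in>{R<..<R + \<epsilon>}. 1 < 2 * Phi1 \<phi> x)"
    and R': "R < R' \<and> R' < 1"
  then obtain \<epsilon> where \<epsilon>: "\<epsilon> > 0" "\<And>x. x \<in> {R<..<R + \<epsilon>} \<Longrightarrow> 1 < 2 * Phi1 \<phi> x" by auto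
  obtain r where r: "R < r" "r < min R' (R + \<epsilon>)"
    using dense[of R "min R' (R + \<epsilon>)"] R' \<epsilon>(1) by auto
  let ?f = "\<lambda>z::complex. 1 / (1 - z)"
  have "has_power_series ?f (\<lambda>_. 1)"
    using geometric_sums by (auto simp: has_power_series_def)
  moreover have "summable (\<lambda>n. \<phi> (Suc n) r)"
    using r R' \<open>0 < R\<close> by (intro bohr_family_summable[OF assms(1)]) auto
  moreover have "infdist (?f 0) (frontier (?f ` unit_disc)) < (\<Sum>n. \<phi> (Suc n) r)"
    using infdist_frontier_inverse_one_minus_disc \<epsilon>(2)[of r] r by (simp add: Phi1_def)
  ultimately show "\<exists>f g b r. convex_univalent f \<and> g \<in> subordination_class f \<and>
      has_power_series g b \<and> r \<in> {R<..<R'} \<and>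
      summable (\<lambda>n. norm (b (Suc n)) * \<phi> (Suc n) r) \<and>
      (\<Sum>n. norm (b (Suc n)) * \<phi> (Suc n) r) > infdist (f 0) (frontier (f ` unit_disc))"
    using r convex_univalent_inverse_one_minus
      convex_univalent_in_subordination_class[OF convex_univalent_inverse_one_minus]
    by (intro exI[of _ ?f] exI[of _ "\<lambda>_. 1"] exI[of _ r]) auto
qed

end
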